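(* Let $f:[0,1]\to[0,1]$ be effectively Baire 2, with a double sequence $(f_{n,m})_{n,m\in\mathbb{N}}$ of continuous functions on $[0,1]$ such that $f(x)=\lim_{n\to\infty}\lim_{m\to\infty}f_{n,m}(x)$ for all $x\in[0,1]$, this double sequence being given as input. Then for any $p,q\in\mathbb{Q}\cap[0,1]$, the supremum $\sup_{x\in[p,q]}f(x)$ is computable (in Kleene's S1–S9 sense) in $\mathsf{S}^{2}$.
   Context: Computability is Kleene's higher-order computability given by S1–S9. $\mathsf{S}^{2}$ is the Suslin functional: $\mathsf{S}:\mathbb{N}^{\mathbb{N}}\to\{0,1\}$ with $\mathsf{S}(f)=0\leftrightarrow(\exists g\in\mathbb{N}^{\mathbb{N}})(\forall n\in\mathbb{N})(f(\overline{g}n)=0)$, where $\overline{g}n$ codes the initial segment of $g$ of length $n$. A function $f:[0,1]\to\mathbb{R}$ is effectively Baire 2 if there is a double sequence of continuous functions $f_{n,m}$ on $[0,1]$ with $f(x)=\lim_{n}\lim_{m}f_{n,m}(x)$ for all $x\in[0,1]$. *)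

theory Defs
  imports "HOL-Analysis.Analysis"
begin

type_synonym tp1 = "nat \<Rightarrow> nat"
type_synonym tp2 = "tp1 \<Rightarrow> nat"

definition sig :: "nat list \<Rightarrow> tp1 list \<Rightarrow> tp2 list \<Rightarrow> nat" where
  "sig xs fs Fs = list_encode [length xs, length fs, length Fs]"

text \<open>
  Kleene's schemata S1--S9 for argument lists of types 0, 1 and 2 (\<open>xs\<close>, \<open>fs\<close>, \<open>Fs\<close>):
  \<open>Kleene e xs fs Fs v\<close> means that \<open>{e}(xs, fs, Fs)\<close> is defined and has value \<open>v\<close>.
  No schema ever introduces an argument of a type higher than the types already present
  (S8 at type 2 only adds a number), so for such arguments this is the full definition.
  As in Kleene's original indexing, an index records the number of its schema, the signature of
  its argument list and the parameters of the schema; finite sequences are coded by the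
  bijection \<^const>\<open>list_encode\<close>.
  S6 moves the argument of type \<open>j\<close> at position \<open>k\<close> to the front of the type-\<open>j\<close> arguments.
  In S8 the premise forces \<open>\<lambda>n. {h}(n, \<dots>)\<close> to be total.
\<close>

inductive Kleene :: "nat \<Rightarrow> nat list \<Rightarrow> tp1 list \<Rightarrow> tp2 list \<Rightarrow> nat \<Rightarrow> bool" where
  S1: "Kleene (list_encode [1, sig (x # xs) fs Fs]) (x # xs) fs Fs (Suc x)"
| S2: "Kleene (list_encode [2, sig xs fs Fs, c]) xs fs Fs c"
| S3: "Kleene (list_encode [3, sig (x # xs) fs Fs]) (x # xs) fs Fs x"
| S4: "Kleene h xs fs Fs u \<Longrightarrow> Kleene g (u # xs) fs Fs v
       \<Longrightarrow> Kleene (list_encode [4, sig xs fs Fs, g, h]) xs fs Fs v"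
| S5_0: "Kleene g xs fs Fs v
       \<Longrightarrow> Kleene (list_encode [5, sig (0 # xs) fs Fs, g, h]) (0 # xs) fs Fs v"
| S5_Suc: "Kleene (list_encode [5, sig (x # xs) fs Fs, g, h]) (x # xs) fs Fs u
       \<Longrightarrow> Kleene h (x # u # xs) fs Fs v
       \<Longrightarrow> Kleene (list_encode [5, sig (Suc x # xs) fs Fs, g, h]) (Suc x # xs) fs Fs v"
| S6_0: "k < length xs \<Longrightarrow> Kleene g (xs ! k # take k xs @ drop (Suc k) xs) fs Fs v
       \<Longrightarrow> Kleene (list_encode [6, sig xs fs Fs, 0, k, g]) xs fs Fs v"
| S6_1: "k < length fs \<Longrightarrow> Kleene g xs (fs ! k # take k fs @ drop (Suc k) fs) Fs v
       \<Longrightarrow> Kleene (list_encode [6, sig xs fs Fs, 1, k, g]) xs fs Fs v"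
| S6_2: "k < length Fs \<Longrightarrow> Kleene g xs fs (Fs ! k # take k Fs @ drop (Suc k) Fs) v
       \<Longrightarrow> Kleene (list_encode [6, sig xs fs Fs, 2, k, g]) xs fs Fs v"
| S7: "Kleene (list_encode [7, sig (x # xs) (f # fs) Fs]) (x # xs) (f # fs) Fs (f x)"
| S8: "(\<And>n. Kleene h (n # xs) fs (F # Fs) (\<alpha> n))
       \<Longrightarrow> Kleene (list_encode [8, sig xs fs (F # Fs), 2, h]) xs fs (F # Fs) (F \<alpha>)"
| S9: "Kleene a xs fs Fs v
       \<Longrightarrow> Kleene (list_encode [9, sig (a # xs @ ys) (fs @ gs) (Fs @ Gs), sig xs fs Fs])
              (a # xs @ ys) (fs @ gs) (Fs @ Gs) v"

definition initial_segment :: "tp1 \<Rightarrow> nat \<Rightarrow> nat" where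
  "initial_segment g n = list_encode (map g [0..<n])"

definition Suslin :: tp2 where
  "Suslin f = (if \<exists>g. \<forall>n. f (initial_segment g n) = 0 then 0 else 1)"

definition rat_code :: "nat \<Rightarrow> real" where
  "rat_code a = of_rat (nat_to_rat_surj a)"

definition real_name :: "tp1 \<Rightarrow> real \<Rightarrow> bool" where
  "real_name y r \<longleftrightarrow>
     (\<forall>n i. \<bar>rat_code (y n) - rat_code (y (n + i))\<bar> < 1 / 2 ^ n) \<and>
     (\<lambda>n. rat_code (y n)) \<longlonglongrightarrow> r"

text \<open>
  A double sequence of functions on \<open>[0,1]\<close> acts on names of reals, i.e. is an object taking
  \<open>n\<close>, \<open>m\<close>, a name \<open>x\<close> and \<open>k\<close> to a number. It is presented as an object of pure type 2 by
  prefixing the numbers \<open>n\<close>, \<open>m\<close>, \<open>k\<close> to the name. No continuity data is included.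
\<close>

definition double_seq_name :: "tp2 \<Rightarrow> (nat \<Rightarrow> nat \<Rightarrow> real \<Rightarrow> real) \<Rightarrow> bool" where
  "double_seq_name \<Phi> F \<longleftrightarrow>
     (\<forall>n m. \<forall>r\<in>{0..1}. \<forall>x. real_name x r \<longrightarrow>
        real_name (\<lambda>k. \<Phi> (case_nat n (case_nat m (case_nat k x)))) (F n m r))"

definition effectively_Baire2_by ::
    "(real \<Rightarrow> real) \<Rightarrow> (nat \<Rightarrow> nat \<Rightarrow> real \<Rightarrow> real) \<Rightarrow> bool" where
  "effectively_Baire2_by f F \<longleftrightarrow>
     (\<forall>n m. continuous_on {0..1} (F n m)) \<and>
     (\<forall>x\<in>{0..1}. (\<forall>n. convergent (\<lambda>m. F n m x)) \<and>
                 (\<lambda>n. lim (\<lambda>m. F n m x)) \<longlonglongrightarrow> f x)"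

definition Kleene_computes_real :: "nat \<Rightarrow> nat list \<Rightarrow> tp2 list \<Rightarrow> real \<Rightarrow> bool" where
  "Kleene_computes_real e xs Fs r \<longleftrightarrow>
     (\<exists>y. real_name y r \<and> (\<forall>k. Kleene e (k # xs) [] Fs (y k)))"

end

theory Submission
  imports Defs
begin

text \<open>
  For rational \<open>r\<close> the statement \<open>sup f > r\<close> is put in the form \<open>\<exists>g. \<forall>l. T (g restricted to l)\<close>
  with \<open>T\<close> computable in \<open>\<Phi>\<close>, so that \<open>Suslin\<close> decides it; the supremum is then located among the
  multiples of \<open>2\<^sup>-\<^sup>k\<close>. First, \<open>f z > r\<close> holds iff there are \<open>N\<close> and \<open>M :: nat \<Rightarrow> nat\<close> with
  \<open>F n m z \<ge> r + 2\<^sup>-\<^sup>N\<close> for all \<open>n \<ge> N\<close>, \<open>m \<ge> M n\<close>. Second, since no modulus of continuity is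
  available and \<open>Suslin\<close> only inspects finite pieces of \<open>g\<close>, the real \<open>z\<close> is represented by a family
  of rationals \<open>s n m j\<close> in \<open>[p, q]\<close> with \<open>\<bar>s n m j - z\<bar> \<le> 2\<^sup>-\<^sup>j\<close>, guessed so close to \<open>z\<close> that
  \<open>F n m (s n m j)\<close> is within \<open>2\<^sup>-\<^sup>j\<close> of \<open>F n m z\<close>; by continuity the inequality for \<open>z\<close> follows from
  those for the \<open>s n m j\<close> up to \<open>O(2\<^sup>-\<^sup>j)\<close>, and \<open>\<Phi>\<close> is only queried at constant names. The bounds are
  monotone, so \<open>N\<close> may be taken to be \<open>M 0\<close>.
\<close>

section \<open>Functions computable in the Suslin functional and a parameter\<close>

text \<open>\<open>computable n f\<close> refers to arguments \<open>\<rho> 0, \<dots>, \<rho> (n - 1)\<close>; with an environment \<open>\<rho>\<close> instead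
  of a list, binding a variable is the shift \<open>\<lambda>i. \<rho> (Suc i)\<close> and the closure rules below unify as
  higher-order patterns. Truth is coded by \<open>0\<close>, as in \<^const>\<open>Suslin\<close>.\<close>

definition computable :: "nat \<Rightarrow> (tp2 \<Rightarrow> (nat \<Rightarrow> nat) \<Rightarrow> nat) \<Rightarrow> bool" where
  "computable n f \<longleftrightarrow>
     (\<exists>e. \<forall>\<Phi> \<rho>. Kleene e (map \<rho> [0..<n]) [] [Suslin, \<Phi>] (f \<Phi> \<rho>))"

definition decidable :: "nat \<Rightarrow> (tp2 \<Rightarrow> (nat \<Rightarrow> nat) \<Rightarrow> bool) \<Rightarrow> bool" where
  "decidable n P \<longleftrightarrow> computable n (\<lambda>\<Phi> \<rho>. if P \<Phi> \<rho> then 0 else 1)"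

named_theorems computable_intros

lemma map_upt_env: "map \<rho> [0..<Suc n] = \<rho> 0 # map (\<lambda>i. \<rho> (Suc i)) [0..<n]"
  by (simp add: map_upt_Suc del: upt_Suc)

lemma computable_const [computable_intros]: "computable n (\<lambda>\<Phi> \<rho>. c)"
proof -
  have "Kleene (list_encode [2, list_encode [n, 0, 2], c]) (map \<rho> [0..<n]) [] [Suslin, \<Phi>] c" for \<rho> \<Phi>
    using S2[of "map \<rho> [0..<n]" "[]" "[Suslin, \<Phi>]" c] by (simp add: sig_def numeral_2_eq_2)
  then show ?thesis unfolding computable_def by blast
qed

text \<open>S6 brings the wanted argument to the front, where S3 reads it. The index depends only on
  \<open>i\<close> and the length, hence is uniform in the list.\<close>

lemma Kleene_nth:
  assumes "i < k"
  shows "\<exists>e. \<forall>xs \<Phi>. length xs = k \<longrightarrow> Kleene e xs [] [Suslin, \<Phi>] (xs ! i)"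
proof (intro exI allI impI)
  fix xs :: "nat list" and \<Phi> assume l: "length xs = k"
  let ?ys = "take i xs @ drop (Suc i) xs"
  have "length ?ys = k - 1" using l assms by auto
  then have "Kleene (list_encode [3, list_encode [Suc (k - 1), 0, 2]]) (xs ! i # ?ys) [] [Suslin, \<Phi>] (xs ! i)"
    using S3[of "xs ! i" ?ys "[]" "[Suslin, \<Phi>]"] by (simp add: sig_def numeral_2_eq_2 del: length_append)
  from S6_0[OF _ this] show
    "Kleene (list_encode [6, list_encode [k, 0, 2], 0, i, list_encode [3, list_encode [Suc (k - 1), 0, 2]]])
       xs [] [Suslin, \<Phi>] (xs ! i)"
    using l assms by (simp add: sig_def numeral_2_eq_2)
qed

lemma computable_var [computable_intros]:
  assumes "i < n"
  shows "computable n (\<lambda>\<Phi> \<rho>. \<rho> i)"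
proof -
  obtain e where "\<forall>xs \<Phi>. length xs = n \<longrightarrow> Kleene e xs [] [Suslin, \<Phi>] (xs ! i)"
    using Kleene_nth[OF assms] by blast
  then have "Kleene e (map \<rho> [0..<n]) [] [Suslin, \<Phi>] (map \<rho> [0..<n] ! i)" for \<rho> \<Phi>
    by simp
  then show ?thesis using assms unfolding computable_def by auto
qed

text \<open>S9 runs an index on an initial part of its arguments and ignores the rest. Since it
  expects that index as first argument, S2 supplies \<open>e\<close> as a constant and S4 prepends
  it.\<close>

lemma Kleene_drop:
  "\<exists>e'. \<forall>xs ys \<Phi> v. length xs = m \<longrightarrow> length ys = d \<longrightarrow>
     Kleene e xs [] [Suslin, \<Phi>] v \<longrightarrow> Kleene e' (xs @ ys) [] [Suslin, \<Phi>] v"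
proof (intro exI allI impI)
  fix xs ys :: "nat list" and \<Phi> v
  assume l: "length xs = m" "length ys = d" and K: "Kleene e xs [] [Suslin, \<Phi>] v"
  have c: "Kleene (list_encode [2, list_encode [m + d, 0, 2], e]) (xs @ ys) [] [Suslin, \<Phi>] e"
    using S2[of "xs @ ys" "[]" "[Suslin, \<Phi>]" e] l by (simp add: sig_def numeral_2_eq_2)
  have "Kleene (list_encode [9, list_encode [Suc (m + d), 0, 2], list_encode [m, 0, 2]]) (e # xs @ ys) []
      [Suslin, \<Phi>] v"
    using S9[OF K, of ys "[]" "[]"] l by (simp add: sig_def numeral_2_eq_2)
  from S4[OF c this] show "Kleene (list_encode [4, list_encode [m + d, 0, 2],
      list_encode [9, list_encode [Suc (m + d), 0, 2], list_encode [m, 0, 2]],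
      list_encode [2, list_encode [m + d, 0, 2], e]]) (xs @ ys) [] [Suslin, \<Phi>] v"
    using l by (simp add: sig_def numeral_2_eq_2)
qed

text \<open>An S4 index records only the signature, \<open>g\<close> and \<open>h\<close>, so one
  index serves all lists of length \<open>k\<close>.\<close>

lemma Kleene_comp:
  "\<exists>e. \<forall>xs \<Phi> u v. length xs = k \<longrightarrow> Kleene h xs [] [Suslin, \<Phi>] u \<longrightarrow>
     Kleene g (u # xs) [] [Suslin, \<Phi>] v \<longrightarrow> Kleene e xs [] [Suslin, \<Phi>] v"
proof (intro exI allI impI)
  fix xs :: "nat list" and \<Phi> u v
  assume l: "length xs = k" and h: "Kleene h xs [] [Suslin, \<Phi>] u"
    and g: "Kleene g (u # xs) [] [Suslin, \<Phi>] v"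
  show "Kleene (list_encode [4, list_encode [k, 0, 2], g, h]) xs [] [Suslin, \<Phi>] v"
    using S4[OF h g] l by (simp add: sig_def numeral_2_eq_2)
qed

text \<open>The front value can be read off the remaining list, so S4 turns an index for the longer
  list into one for the shorter; induction removes the whole prefix. Prefixes of variables come
  first because \<open>computable_push\<close> relies on \<open>computable_rename\<close>, which
  relies on this case.\<close>

lemma computable_push_vars:
  assumes "\<forall>i\<in>set is. i < n"
    and "\<exists>e. \<forall>\<Phi> \<rho>. Kleene e (map \<rho> is @ map \<rho> [0..<n]) [] [Suslin, \<Phi>] (G \<Phi> \<rho>)"
  shows "computable n G"
  using assms
proof (induction "is")
  case Nil
  then show ?case by (simp add: computable_def)
next
  case (Cons i "is")
  let ?k = "length is + n"
  obtain g where g: "\<And>\<Phi> \<rho>. Kleene g (\<rho> i # map \<rho> is @ map \<rho> [0..<n]) [] [Suslin, \<Phi>] (G \<Phi> \<rho>)"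
    using Cons.prems by auto
  obtain h where h: "\<And>xs \<Phi>. length xs = ?k \<Longrightarrow> Kleene h xs [] [Suslin, \<Phi>] (xs ! (length is + i))"
    using Kleene_nth[of "length is + i" ?k] Cons.prems by auto
  obtain e where e: "\<And>xs \<Phi> u v. length xs = ?k \<Longrightarrow> Kleene h xs [] [Suslin, \<Phi>] u \<Longrightarrow>
     Kleene g (u # xs) [] [Suslin, \<Phi>] v \<Longrightarrow> Kleene e xs [] [Suslin, \<Phi>] v"
    using Kleene_comp[of ?k h g] by blast
  have "Kleene e (map \<rho> is @ map \<rho> [0..<n]) [] [Suslin, \<Phi>] (G \<Phi> \<rho>)" for \<Phi> \<rho>
  proof (rule e)
    show "Kleene h (map \<rho> is @ map \<rho> [0..<n]) [] [Suslin, \<Phi>] (\<rho> i)"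
      using h[of "map \<rho> is @ map \<rho> [0..<n]" \<Phi>] Cons.prems
      by (auto simp: nth_append)
  qed (use g in auto)
  then show ?case using Cons by auto
qed

text \<open>The renamed variables are placed in front of the old list, and the old list is then
  discarded by \<open>Kleene_drop\<close>.\<close>

lemma computable_rename:
  assumes "computable m g" "\<And>i. i < m \<Longrightarrow> \<pi> i < n"
  shows "computable n (\<lambda>\<Phi> \<rho>. g \<Phi> (\<lambda>i. \<rho> (\<pi> i)))"
proof -
  obtain a where a: "\<And>\<Phi> \<rho>. Kleene a (map \<rho> [0..<m]) [] [Suslin, \<Phi>] (g \<Phi> \<rho>)"
    using assms(1) unfolding computable_def by blast
  obtain e where e: "\<And>xs ys \<Phi> v. length xs = m \<Longrightarrow> length ys = n \<Longrightarrow>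
     Kleene a xs [] [Suslin, \<Phi>] v \<Longrightarrow> Kleene e (xs @ ys) [] [Suslin, \<Phi>] v"
    using Kleene_drop[of m n a] by blast
  have "Kleene e (map \<rho> (map \<pi> [0..<m]) @ map \<rho> [0..<n]) [] [Suslin, \<Phi>] (g \<Phi> (\<lambda>i. \<rho> (\<pi> i)))" for \<Phi> \<rho>
    by (rule e) (use a[of "\<lambda>i. \<rho> (\<pi> i)" \<Phi>] in \<open>auto simp: o_def\<close>)
  then show ?thesis
    by (intro computable_push_vars[of "map \<pi> [0..<m]"]) (use assms(2) in auto)
qed

text \<open>As for variables, but \<open>h\<close> must skip the values already standing in front of
  its own arguments; this shift is a renaming.\<close>

lemma computable_push:
  assumes "\<forall>h\<in>set hs. computable n h"
    and "\<exists>e. \<forall>\<Phi> \<rho>. Kleene e (map (\<lambda>h. h \<Phi> \<rho>) hs @ map \<rho> [0..<n]) [] [Suslin, \<Phi>] (G \<Phi> \<rho>)"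
  shows "computable n G"
  using assms
proof (induction hs)
  case Nil
  then show ?case by (simp add: computable_def)
next
  case (Cons h hs)
  let ?d = "length hs" let ?k = "?d + n"
  obtain g where g: "\<And>\<Phi> \<rho>. Kleene g (h \<Phi> \<rho> # map (\<lambda>h. h \<Phi> \<rho>) hs @ map \<rho> [0..<n]) [] [Suslin, \<Phi>] (G \<Phi> \<rho>)"
    using Cons.prems by auto
  have "computable ?k (\<lambda>\<Phi> \<rho>. h \<Phi> (\<lambda>i. \<rho> (?d + i)))"
    using Cons.prems by (intro computable_rename[of n h "\<lambda>i. ?d + i"]) auto
  then obtain a where a: "\<And>\<Phi> \<rho>. Kleene a (map \<rho> [0..<?k]) [] [Suslin, \<Phi>] (h \<Phi> (\<lambda>i. \<rho> (?d + i)))"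
    unfolding computable_def by blast
  obtain e where e: "\<And>xs \<Phi> u v. length xs = ?k \<Longrightarrow> Kleene a xs [] [Suslin, \<Phi>] u \<Longrightarrow>
     Kleene g (u # xs) [] [Suslin, \<Phi>] v \<Longrightarrow> Kleene e xs [] [Suslin, \<Phi>] v"
    using Kleene_comp[of ?k a g] by blast
  have "Kleene e (map (\<lambda>h. h \<Phi> \<rho>) hs @ map \<rho> [0..<n]) [] [Suslin, \<Phi>] (G \<Phi> \<rho>)" for \<Phi> \<rho>
  proof (rule e)
    \<comment> \<open>The environment whose first entries form the concatenated list, so that the
      shifted index \<open>a\<close> applies to it.\<close>
    let ?\<rho> = "\<lambda>i. if i < ?d then (hs ! i) \<Phi> \<rho> else \<rho> (i - ?d)"
    have "map ?\<rho> [0..<?k] = map (\<lambda>h. h \<Phi> \<rho>) hs @ map \<rho> [0..<n]"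
      by (rule nth_equalityI) (auto simp: nth_append)
    then show "Kleene a (map (\<lambda>h. h \<Phi> \<rho>) hs @ map \<rho> [0..<n]) [] [Suslin, \<Phi>] (h \<Phi> \<rho>)"
      using a[of ?\<rho> \<Phi>] by simp
  qed (use g in auto)
  then show ?case using Cons by auto
qed

lemma computable_subst:
  assumes "computable m g" "\<And>i. i < m \<Longrightarrow> computable n (h i)"
  shows "computable n (\<lambda>\<Phi> \<rho>. g \<Phi> (\<lambda>i. h i \<Phi> \<rho>))"
proof -
  obtain a where a: "\<And>\<Phi> \<rho>. Kleene a (map \<rho> [0..<m]) [] [Suslin, \<Phi>] (g \<Phi> \<rho>)"
    using assms(1) unfolding computable_def by blast
  obtain e where e: "\<And>xs ys \<Phi> v. length xs = m \<Longrightarrow> length ys = n \<Longrightarrow>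
     Kleene a xs [] [Suslin, \<Phi>] v \<Longrightarrow> Kleene e (xs @ ys) [] [Suslin, \<Phi>] v"
    using Kleene_drop[of m n a] by blast
  have "Kleene e (map (\<lambda>h. h \<Phi> \<rho>) (map h [0..<m]) @ map \<rho> [0..<n]) [] [Suslin, \<Phi>] (g \<Phi> (\<lambda>i. h i \<Phi> \<rho>))" for \<Phi> \<rho>
    by (rule e) (use a[of "\<lambda>i. h i \<Phi> \<rho>" \<Phi>] in \<open>auto simp: o_def\<close>)
  then show ?thesis
    by (intro computable_push[of "map h [0..<m]"]) (use assms(2) in auto)
qed

lemma computable_app1:
  assumes "computable 1 (\<lambda>\<Phi> \<rho>. f \<Phi> (\<rho> 0))" "computable n a"
  shows "computable n (\<lambda>\<Phi> \<rho>. f \<Phi> (a \<Phi> \<rho>))"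
  using computable_subst[OF assms(1), of n "\<lambda>i. a"] assms(2) by simp

lemma computable_app2:
  assumes "computable 2 (\<lambda>\<Phi> \<rho>. f \<Phi> (\<rho> 0) (\<rho> 1))" "computable n a" "computable n b"
  shows "computable n (\<lambda>\<Phi> \<rho>. f \<Phi> (a \<Phi> \<rho>) (b \<Phi> \<rho>))"
  using computable_subst[OF assms(1), of n "\<lambda>i. if i = 0 then a else b"] assms(2,3) by simp

lemma computable_app3:
  assumes "computable 3 (\<lambda>\<Phi> \<rho>. f \<Phi> (\<rho> 0) (\<rho> 1) (\<rho> 2))"
    "computable n a" "computable n b" "computable n c"
  shows "computable n (\<lambda>\<Phi> \<rho>. f \<Phi> (a \<Phi> \<rho>) (b \<Phi> \<rho>) (c \<Phi> \<rho>))"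
  using computable_subst[OF assms(1), of n "\<lambda>i. if i = 0 then a else if i = 1 then b else c"] assms(2-4)
  by simp

lemma computable_app4:
  assumes "computable 4 (\<lambda>\<Phi> \<rho>. f \<Phi> (\<rho> 0) (\<rho> 1) (\<rho> 2) (\<rho> 3))"
    "computable n a" "computable n b" "computable n c" "computable n d"
  shows "computable n (\<lambda>\<Phi> \<rho>. f \<Phi> (a \<Phi> \<rho>) (b \<Phi> \<rho>) (c \<Phi> \<rho>) (d \<Phi> \<rho>))"
  using computable_subst[OF assms(1), of n
      "\<lambda>i. if i = 0 then a else if i = 1 then b else if i = 2 then c else d"] assms(2-5)
  by simp

lemma computable_Suc [computable_intros]:
  assumes "computable n a"
  shows "computable n (\<lambda>\<Phi> \<rho>. Suc (a \<Phi> \<rho>))"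
proof -
  have "Kleene (list_encode [1, list_encode [1, 0, 2]]) (map \<rho> [0..<1]) [] [Suslin, \<Phi>] (Suc (\<rho> 0))" for \<rho> \<Phi>
    using S1[of "\<rho> 0" "[]" "[]" "[Suslin, \<Phi>]"] by (simp add: sig_def numeral_2_eq_2)
  then have "computable 1 (\<lambda>\<Phi> \<rho>. Suc (\<rho> 0))" unfolding computable_def by blast
  from computable_app1[OF this assms] show ?thesis .
qed

text \<open>S5 recurses on the first argument. The recursion is therefore run on a new front
  argument, into which \<open>b\<close> is substituted at the end.\<close>

lemma computable_rec_nat [computable_intros]:
  assumes "computable n a" "computable n b"
    and "computable (Suc (Suc n)) (\<lambda>\<Phi> \<rho>. s \<Phi> (\<rho> 0) (\<rho> 1) (\<lambda>i. \<rho> (Suc (Suc i))))"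
  shows "computable n (\<lambda>\<Phi> \<rho>. rec_nat (a \<Phi> \<rho>) (\<lambda>x u. s \<Phi> x u \<rho>) (b \<Phi> \<rho>))"
proof -
  obtain g where g: "\<And>\<Phi> \<rho>. Kleene g (map \<rho> [0..<n]) [] [Suslin, \<Phi>] (a \<Phi> \<rho>)"
    using assms(1) unfolding computable_def by blast
  obtain h where h: "\<And>\<Phi> \<rho>. Kleene h (map \<rho> [0..<Suc (Suc n)]) [] [Suslin, \<Phi>]
      (s \<Phi> (\<rho> 0) (\<rho> 1) (\<lambda>i. \<rho> (Suc (Suc i))))"
    using assms(3) unfolding computable_def by blast
  have h': "Kleene h (x # u # map \<rho> [0..<n]) [] [Suslin, \<Phi>] (s \<Phi> x u \<rho>)" for x u \<rho> \<Phi>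
    using h[of "case_nat x (case_nat u \<rho>)" \<Phi>] by (simp add: map_upt_env del: upt_Suc)
  let ?e = "list_encode [5, list_encode [Suc n, 0, 2], g, h]"
  have e: "Kleene ?e (x # map \<rho> [0..<n]) [] [Suslin, \<Phi>] (rec_nat (a \<Phi> \<rho>) (\<lambda>x u. s \<Phi> x u \<rho>) x)" for x \<rho> \<Phi>
  proof (induction x)
    case 0
    then show ?case using S5_0[OF g[of \<rho> \<Phi>], of h] by (simp add: sig_def numeral_2_eq_2)
  next
    case (Suc x)
    have "Kleene (list_encode [5, sig (x # map \<rho> [0..<n]) [] [Suslin, \<Phi>], g, h]) (x # map \<rho> [0..<n]) []
        [Suslin, \<Phi>] (rec_nat (a \<Phi> \<rho>) (\<lambda>x u. s \<Phi> x u \<rho>) x)"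
      using Suc by (simp add: sig_def numeral_2_eq_2)
    from S5_Suc[OF this h'] show ?case by (simp add: sig_def numeral_2_eq_2)
  qed
  then have "\<exists>e. \<forall>\<Phi> \<rho>. Kleene e (map (\<lambda>h. h \<Phi> \<rho>) [b] @ map \<rho> [0..<n]) [] [Suslin, \<Phi>]
      (rec_nat (a \<Phi> \<rho>) (\<lambda>x u. s \<Phi> x u \<rho>) (b \<Phi> \<rho>))"
    by auto
  then show ?thesis using assms(2) by (intro computable_push[of "[b]"]) auto
qed

lemma computable_Suslin [computable_intros]:
  assumes "computable (Suc n) (\<lambda>\<Phi> \<rho>. g \<Phi> (\<rho> 0) (\<lambda>i. \<rho> (Suc i)))"
  shows "computable n (\<lambda>\<Phi> \<rho>. Suslin (\<lambda>i. g \<Phi> i \<rho>))"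
proof -
  obtain h where h: "\<forall>\<Phi> \<rho>. Kleene h (map \<rho> [0..<Suc n]) [] [Suslin, \<Phi>] (g \<Phi> (\<rho> 0) (\<lambda>i. \<rho> (Suc i)))"
    using assms unfolding computable_def ..
  have h': "Kleene h (x # map \<rho> [0..<n]) [] [Suslin, \<Phi>] (g \<Phi> x \<rho>)" for x \<rho> \<Phi>
    using h[rule_format, of "case_nat x \<rho>" \<Phi>] by (simp add: map_upt_env del: upt_Suc)
  have "Kleene (list_encode [8, list_encode [n, 0, 2], 2, h]) (map \<rho> [0..<n]) [] [Suslin, \<Phi>]
      (Suslin (\<lambda>i. g \<Phi> i \<rho>))" for \<rho> \<Phi>
    using S8[of h "map \<rho> [0..<n]" "[]" Suslin "[\<Phi>]" "\<lambda>x. g \<Phi> x \<rho>"] h'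
    by (simp add: sig_def numeral_2_eq_2)
  then show ?thesis unfolding computable_def by blast
qed

text \<open>S8 applies only the first functional, so S6 exchanges \<open>Suslin\<close> and
  \<open>\<Phi>\<close> before it. Inside S8 the exchanged order persists, and a second exchange
  restores the order that \<open>h\<close> expects.\<close>

lemma computable_functional [computable_intros]:
  assumes "computable (Suc n) (\<lambda>\<Phi> \<rho>. g \<Phi> (\<rho> 0) (\<lambda>i. \<rho> (Suc i)))"
  shows "computable n (\<lambda>\<Phi> \<rho>. \<Phi> (\<lambda>i. g \<Phi> i \<rho>))"
proof -
  obtain h where h: "\<forall>\<Phi> \<rho>. Kleene h (map \<rho> [0..<Suc n]) [] [Suslin, \<Phi>] (g \<Phi> (\<rho> 0) (\<lambda>i. \<rho> (Suc i)))"
    using assms unfolding computable_def ..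
  let ?h = "list_encode [6, list_encode [Suc n, 0, 2], 2, 1, h]"
  let ?k = "list_encode [8, list_encode [n, 0, 2], 2, ?h]"
  have h': "Kleene ?h (x # map \<rho> [0..<n]) [] [\<Phi>, Suslin] (g \<Phi> x \<rho>)" for x \<rho> \<Phi>
    using h[rule_format, of "case_nat x \<rho>" \<Phi>]
      S6_2[of 1 "[\<Phi>, Suslin]" h "x # map \<rho> [0..<n]" "[]" "g \<Phi> x \<rho>"]
    by (simp add: map_upt_env sig_def numeral_2_eq_2 del: upt_Suc)
  have k: "Kleene ?k (map \<rho> [0..<n]) [] [\<Phi>, Suslin] (\<Phi> (\<lambda>i. g \<Phi> i \<rho>))" for \<rho> \<Phi>
    using S8[of ?h "map \<rho> [0..<n]" "[]" \<Phi> "[Suslin]" "\<lambda>x. g \<Phi> x \<rho>"] h'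
    by (simp add: sig_def numeral_2_eq_2)
  have "Kleene (list_encode [6, list_encode [n, 0, 2], 2, 1, ?k]) (map \<rho> [0..<n]) [] [Suslin, \<Phi>]
      (\<Phi> (\<lambda>i. g \<Phi> i \<rho>))" for \<rho> \<Phi>
    using k[of \<rho> \<Phi>] S6_2[of 1 "[Suslin, \<Phi>]" ?k "map \<rho> [0..<n]" "[]" "\<Phi> (\<lambda>i. g \<Phi> i \<rho>)"]
    by (simp add: sig_def numeral_2_eq_2)
  then show ?thesis unfolding computable_def by blast
qed

section \<open>Arithmetic and codes\<close>

lemma computable_pred [computable_intros]:
  assumes "computable n a"
  shows "computable n (\<lambda>\<Phi> \<rho>. a \<Phi> \<rho> - Suc 0)"
proof (rule computable_app1[OF _ assms])
  have eq: "x - Suc 0 = rec_nat 0 (\<lambda>y u. y) x" for x :: nat by (cases x) auto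
  show "computable 1 (\<lambda>\<Phi> \<rho>. \<rho> 0 - Suc 0)"
    unfolding eq by (intro computable_intros) auto
qed

lemma computable_add [computable_intros]:
  assumes "computable n a" "computable n b"
  shows "computable n (\<lambda>\<Phi> \<rho>. a \<Phi> \<rho> + b \<Phi> \<rho>)"
proof (rule computable_app2[OF _ assms])
  have eq: "x + y = rec_nat x (\<lambda>z u. Suc u) y" for x y :: nat by (induction y) auto
  show "computable 2 (\<lambda>\<Phi> \<rho>. \<rho> 0 + \<rho> 1)"
    unfolding eq by (intro computable_intros) auto
qed

lemma computable_diff [computable_intros]:
  assumes "computable n a" "computable n b"
  shows "computable n (\<lambda>\<Phi> \<rho>. a \<Phi> \<rho> - b \<Phi> \<rho>)"
proof (rule computable_app2[OF _ assms])
  have eq: "x - y = rec_nat x (\<lambda>z u. u - Suc 0) y" for x y :: nat by (induction y) auto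
  show "computable 2 (\<lambda>\<Phi> \<rho>. \<rho> 0 - \<rho> 1)"
    \<comment> \<open>A single rewrite: the right-hand side of \<open>eq\<close> contains a
      subtraction again, so unfolding would loop.\<close>
    by (subst eq) (intro computable_pred computable_intros; simp)
qed

lemma computable_mult [computable_intros]:
  assumes "computable n a" "computable n b"
  shows "computable n (\<lambda>\<Phi> \<rho>. a \<Phi> \<rho> * b \<Phi> \<rho>)"
proof (rule computable_app2[OF _ assms])
  have eq: "x * y = rec_nat 0 (\<lambda>z u. u + x) y" for x y :: nat by (induction y) auto
  show "computable 2 (\<lambda>\<Phi> \<rho>. \<rho> 0 * \<rho> 1)"
    unfolding eq by (intro computable_intros) auto
qed

lemma computable_power [computable_intros]:
  assumes "computable n a" "computable n b"
  shows "computable n (\<lambda>\<Phi> \<rho>. a \<Phi> \<rho> ^ b \<Phi> \<rho>)"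
proof (rule computable_app2[OF _ assms])
  have eq: "x ^ y = rec_nat 1 (\<lambda>z u. x * u) y" for x y :: nat by (induction y) auto
  show "computable 2 (\<lambda>\<Phi> \<rho>. \<rho> 0 ^ \<rho> 1)"
    unfolding eq by (intro computable_intros) auto
qed

lemma computable_If [computable_intros]:
  assumes "decidable n P" "computable n a" "computable n b"
  shows "computable n (\<lambda>\<Phi> \<rho>. if P \<Phi> \<rho> then a \<Phi> \<rho> else b \<Phi> \<rho>)"
proof -
  have "computable 3 (\<lambda>\<Phi> \<rho>. rec_nat (\<rho> 1) (\<lambda>z u. \<rho> 2) (\<rho> 0))"
    by (intro computable_intros) auto
  from computable_app3[where f = "\<lambda>_ x y z. rec_nat y (\<lambda>_ _. z) x", OF this assms(1)[unfolded decidable_def] assms(2,3)]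
  have "computable n (\<lambda>\<Phi> \<rho>. rec_nat (a \<Phi> \<rho>) (\<lambda>_ _. b \<Phi> \<rho>) (if P \<Phi> \<rho> then 0 else 1))" .
  also have "(\<lambda>\<Phi> \<rho>. rec_nat (a \<Phi> \<rho>) (\<lambda>_ _. b \<Phi> \<rho>) (if P \<Phi> \<rho> then 0 else 1)) =
      (\<lambda>\<Phi> \<rho>. if P \<Phi> \<rho> then a \<Phi> \<rho> else b \<Phi> \<rho>)"
    by (auto simp: fun_eq_iff)
  finally show ?thesis .
qed

lemma decidable_zero:
  assumes "computable n a"
  shows "decidable n (\<lambda>\<Phi> \<rho>. a \<Phi> \<rho> = 0)"
proof -
  have "computable 1 (\<lambda>\<Phi> \<rho>. rec_nat 0 (\<lambda>_ _. 1) (\<rho> 0))"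
    by (intro computable_intros) auto
  from computable_app1[where f = "\<lambda>_. rec_nat 0 (\<lambda>_ _. 1)", OF this assms]
  have "computable n (\<lambda>\<Phi> \<rho>. rec_nat 0 (\<lambda>_ _. 1) (a \<Phi> \<rho>))" .
  also have "(\<lambda>\<Phi> \<rho>. rec_nat 0 (\<lambda>_ _. 1) (a \<Phi> \<rho>)) = (\<lambda>\<Phi> \<rho>. if a \<Phi> \<rho> = 0 then 0 else 1)"
    by (auto simp: fun_eq_iff gr0_conv_Suc)
  finally show ?thesis unfolding decidable_def .
qed

lemma decidable_le [computable_intros]:
  assumes "computable n a" "computable n b"
  shows "decidable n (\<lambda>\<Phi> \<rho>. a \<Phi> \<rho> \<le> b \<Phi> \<rho>)"
  using decidable_zero[OF computable_diff[OF assms]] by simp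

lemma decidable_conj [computable_intros]:
  assumes "decidable n P" "decidable n Q"
  shows "decidable n (\<lambda>\<Phi> \<rho>. P \<Phi> \<rho> \<and> Q \<Phi> \<rho>)"
proof -
  have "computable n (\<lambda>\<Phi> \<rho>. if P \<Phi> \<rho> then if Q \<Phi> \<rho> then 0 else 1 else 1)"
    using assms by (intro computable_intros)
  also have "(\<lambda>\<Phi> \<rho>. if P \<Phi> \<rho> then if Q \<Phi> \<rho> then 0 else 1 else 1) =
    (\<lambda>\<Phi> \<rho>. if P \<Phi> \<rho> \<and> Q \<Phi> \<rho> then 0 else (1::nat))" by (auto simp: fun_eq_iff)
  finally show ?thesis unfolding decidable_def .
qed

lemma decidable_imp [computable_intros]:
  assumes "decidable n P" "decidable n Q"
  shows "decidable n (\<lambda>\<Phi> \<rho>. P \<Phi> \<rho> \<longrightarrow> Q \<Phi> \<rho>)"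
proof -
  have "computable n (\<lambda>\<Phi> \<rho>. if P \<Phi> \<rho> then if Q \<Phi> \<rho> then 0 else 1 else 0)"
    using assms by (intro computable_intros)
  also have "(\<lambda>\<Phi> \<rho>. if P \<Phi> \<rho> then if Q \<Phi> \<rho> then 0 else 1 else 0) =
    (\<lambda>\<Phi> \<rho>. if P \<Phi> \<rho> \<longrightarrow> Q \<Phi> \<rho> then 0 else (1::nat))" by (auto simp: fun_eq_iff)
  finally show ?thesis unfolding decidable_def .
qed

lemma computable_case_nat [computable_intros]:
  assumes "computable n a" "computable n b"
    and "computable (Suc n) (\<lambda>\<Phi> \<rho>. s \<Phi> (\<rho> 0) (\<lambda>i. \<rho> (Suc i)))"
  shows "computable n (\<lambda>\<Phi> \<rho>. case_nat (a \<Phi> \<rho>) (\<lambda>x. s \<Phi> x \<rho>) (b \<Phi> \<rho>))"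
proof -
  have "(if i = 0 then 0 else Suc i) < Suc (Suc n)" if "i < Suc n" for i
    using that by auto
  then have "computable (Suc (Suc n)) (\<lambda>\<Phi> \<rho>. s \<Phi> (\<rho> 0) (\<lambda>i. \<rho> (Suc (Suc i))))"
    using computable_rename[OF assms(3), of "\<lambda>i. if i = 0 then 0 else Suc i" "Suc (Suc n)"] by simp
  from computable_rec_nat[OF assms(1,2), of "\<lambda>\<Phi> x u \<rho>. s \<Phi> x \<rho>", OF this]
  have "computable n (\<lambda>\<Phi> \<rho>. rec_nat (a \<Phi> \<rho>) (\<lambda>x u. s \<Phi> x \<rho>) (b \<Phi> \<rho>))" .
  also have "(\<lambda>\<Phi> \<rho>. rec_nat (a \<Phi> \<rho>) (\<lambda>x u. s \<Phi> x \<rho>) (b \<Phi> \<rho>)) =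
     (\<lambda>\<Phi> \<rho>. case_nat (a \<Phi> \<rho>) (\<lambda>x. s \<Phi> x \<rho>) (b \<Phi> \<rho>))"
    by (auto simp: fun_eq_iff split: nat.split)
  finally show ?thesis .
qed

section \<open>Cantor pairing and its inverse\<close>

lemma computable_triangle [computable_intros]:
  assumes "computable n a"
  shows "computable n (\<lambda>\<Phi> \<rho>. triangle (a \<Phi> \<rho>))"
proof (rule computable_app1[OF _ assms])
  have eq: "triangle x = rec_nat 0 (\<lambda>y u. u + Suc y) x" for x by (induction x) auto
  show "computable 1 (\<lambda>\<Phi> \<rho>. triangle (\<rho> 0))"
    unfolding eq by (intro computable_intros) auto
qed

lemma computable_prod_encode [computable_intros]:
  assumes "computable n a" "computable n b"
  shows "computable n (\<lambda>\<Phi> \<rho>. prod_encode (a \<Phi> \<rho>, b \<Phi> \<rho>))"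
  unfolding prod_encode_def prod.case using assms by (intro computable_intros)

text \<open>The diagonal of the pairing that contains the argument. It grows by at most one per
  step, which makes it primitive recursive without a search.\<close>

definition triangle_root :: "nat \<Rightarrow> nat" where
  "triangle_root = rec_nat 0 (\<lambda>z w. if triangle (Suc w) \<le> Suc z then Suc w else w)"

lemma triangle_root_bounds: "triangle (triangle_root z) \<le> z \<and> z < triangle (Suc (triangle_root z))"
  by (induction z) (auto simp: triangle_root_def)

text \<open>The offset of \<open>z\<close> on its diagonal does not exceed the number of the
  diagonal, so \<open>prod_decode_aux\<close> stops at its first call.\<close>

lemma prod_decode_triangle_root:
  "prod_decode z = (z - triangle (triangle_root z), triangle_root z - (z - triangle (triangle_root z)))"
proof -
  let ?w = "triangle_root z"
  have "prod_decode (triangle ?w + (z - triangle ?w)) = prod_decode_aux ?w (z - triangle ?w)"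
    by (rule prod_decode_triangle_add)
  then show ?thesis
    using triangle_root_bounds[of z] by (subst (asm) prod_decode_aux.simps) (auto split: if_splits)
qed

lemma computable_triangle_root [computable_intros]:
  assumes "computable n a"
  shows "computable n (\<lambda>\<Phi> \<rho>. triangle_root (a \<Phi> \<rho>))"
proof (rule computable_app1[OF _ assms])
  show "computable 1 (\<lambda>\<Phi> \<rho>. triangle_root (\<rho> 0))"
    unfolding triangle_root_def by (intro computable_intros) auto
qed

lemma computable_fst_prod_decode [computable_intros]:
  assumes "computable n a"
  shows "computable n (\<lambda>\<Phi> \<rho>. fst (prod_decode (a \<Phi> \<rho>)))"
  unfolding prod_decode_triangle_root fst_conv using assms by (intro computable_intros)

lemma computable_snd_prod_decode [computable_intros]:
  assumes "computable n a"
  shows "computable n (\<lambda>\<Phi> \<rho>. snd (prod_decode (a \<Phi> \<rho>)))"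
  unfolding prod_decode_triangle_root snd_conv using assms by (intro computable_intros)

section \<open>Codes of finite sequences\<close>

definition code_drop :: "nat \<Rightarrow> nat \<Rightarrow> nat" where
  "code_drop \<sigma> = rec_nat \<sigma> (\<lambda>_ u. snd (prod_decode (u - Suc 0)))"

definition code_nth :: "nat \<Rightarrow> nat \<Rightarrow> nat" where
  "code_nth \<sigma> i = fst (prod_decode (code_drop \<sigma> i - Suc 0))"

definition code_length :: "nat \<Rightarrow> nat" where
  "code_length \<sigma> = rec_nat 0 (\<lambda>i u. if code_drop \<sigma> i \<le> 0 then u else Suc u) \<sigma>"

lemma computable_code_drop [computable_intros]:
  assumes "computable n a" "computable n b"
  shows "computable n (\<lambda>\<Phi> \<rho>. code_drop (a \<Phi> \<rho>) (b \<Phi> \<rho>))"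
proof (rule computable_app2[OF _ assms])
  show "computable 2 (\<lambda>\<Phi> \<rho>. code_drop (\<rho> 0) (\<rho> 1))"
    unfolding code_drop_def by (intro computable_intros) auto
qed

lemma computable_code_nth [computable_intros]:
  assumes "computable n a" "computable n b"
  shows "computable n (\<lambda>\<Phi> \<rho>. code_nth (a \<Phi> \<rho>) (b \<Phi> \<rho>))"
  unfolding code_nth_def using assms by (intro computable_intros)

lemma computable_code_length [computable_intros]:
  assumes "computable n a"
  shows "computable n (\<lambda>\<Phi> \<rho>. code_length (a \<Phi> \<rho>))"
proof (rule computable_app1[OF _ assms])
  show "computable 1 (\<lambda>\<Phi> \<rho>. code_length (\<rho> 0))"
    unfolding code_length_def by (intro computable_intros) auto
qed

text \<open>A nonempty list is coded by the successor of the pair of its head and the code of its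
  tail, so the predecessor's second component is the tail.\<close>

lemma code_drop_list_encode: "code_drop (list_encode xs) i = list_encode (drop i xs)"
proof (induction i)
  case (Suc i)
  \<comment> \<open>The empty list has code \<open>0\<close>; truncated subtraction leaves it at
    \<open>0\<close>, and this default makes it its own tail.\<close>
  have "prod_decode 0 = (0, 0)"
    using prod_encode_inverse[of "(0, 0)"] by (simp add: prod_encode_def)
  then have "snd (prod_decode (list_encode ys - Suc 0)) = list_encode (tl ys)" for ys
    by (cases ys) auto
  then show ?case using Suc by (simp add: code_drop_def drop_Suc drop_tl)
qed (simp add: code_drop_def)

lemma code_nth_list_encode: "i < length xs \<Longrightarrow> code_nth (list_encode xs) i = xs ! i"
  by (simp add: code_nth_def code_drop_list_encode flip: Cons_nth_drop_Suc)

text \<open>Justifies that \<open>code_length\<close> counts nonempty tails only up to the code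
  itself.\<close>

lemma length_le_list_encode: "length xs \<le> list_encode xs"
proof (induction xs)
  case (Cons x xs)
  then show ?case using le_prod_encode_2[of "list_encode xs" x] by simp
qed simp

lemma code_length_list_encode: "code_length (list_encode xs) = length xs"
proof -
  have pos: "list_encode ys = 0 \<longleftrightarrow> ys = []" for ys by (cases ys) auto
  have "rec_nat 0 (\<lambda>i u. if code_drop (list_encode xs) i \<le> 0 then u else Suc u) k = min k (length xs)" for k
    by (induction k) (auto simp: code_drop_list_encode pos)
  then show ?thesis using length_le_list_encode[of xs] by (simp add: code_length_def)
qed

lemma code_nth_initial_segment: "i < l \<Longrightarrow> code_nth (initial_segment g l) i = g i"
  by (simp add: initial_segment_def code_nth_list_encode)

lemma code_length_initial_segment: "code_length (initial_segment g l) = l"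
  by (simp add: initial_segment_def code_length_list_encode)

section \<open>Codes of integers and rationals\<close>

lemma computable_half [computable_intros]:
  assumes "computable n a"
  shows "computable n (\<lambda>\<Phi> \<rho>. a \<Phi> \<rho> div 2)"
proof (rule computable_app1[OF _ assms])
  have eq: "x div 2 = rec_nat 0 (\<lambda>y u. y - u) x" for x :: nat
  proof (induction x)
    case (Suc x)
    have "Suc x div 2 = x - x div 2" by linarith
    then show ?case using Suc by simp
  qed simp
  show "computable 1 (\<lambda>\<Phi> \<rho>. \<rho> 0 div 2)"
    unfolding eq by (intro computable_intros) auto
qed

lemma decidable_even [computable_intros]:
  assumes "computable n a"
  shows "decidable n (\<lambda>\<Phi> \<rho>. even (a \<Phi> \<rho>))"
proof -
  have "even x \<longleftrightarrow> x \<le> 2 * (x div 2)" for x :: nat by presburger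
  then show ?thesis using assms by (simp only:) (intro computable_intros)
qed

definition int_pos :: "nat \<Rightarrow> nat" where
  "int_pos z = (if even z then z div 2 else 0)"

definition int_neg :: "nat \<Rightarrow> nat" where
  "int_neg z = (if even z then 0 else Suc (z div 2))"

lemma int_decode_pos_neg: "int_decode z = int (int_pos z) - int (int_neg z)"
  by (simp add: int_decode_def sum_decode_def int_pos_def int_neg_def)

lemma int_pos_neg_0: "int_pos z = 0 \<or> int_neg z = 0"
  by (simp add: int_pos_def int_neg_def)

text \<open>From \<open>x / y = x y / y\<^sup>2\<close>, split into positive and negative part; for \<open>y = 0\<close> both
  numerators vanish, and the denominator is set to \<open>1\<close>.\<close>

definition rat_pos :: "nat \<Rightarrow> nat" where
  "rat_pos c = (let x = fst (prod_decode c); y = snd (prod_decode c) in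
     int_pos x * int_pos y + int_neg x * int_neg y)"

definition rat_neg :: "nat \<Rightarrow> nat" where
  "rat_neg c = (let x = fst (prod_decode c); y = snd (prod_decode c) in
     int_pos x * int_neg y + int_neg x * int_pos y)"

definition rat_den :: "nat \<Rightarrow> nat" where
  "rat_den c = (let y = snd (prod_decode c); d = int_pos y ^ 2 + int_neg y ^ 2 in d + (1 - d))"

lemma rat_den_pos: "rat_den c > 0"
  by (auto simp: rat_den_def Let_def)

lemma rat_code_eq:
  "rat_code c = (real (rat_pos c) - real (rat_neg c)) / real (rat_den c)"
proof -
  obtain x y where c: "prod_decode c = (x, y)" by fastforce
  have "rat_code c = real_of_int (int_decode x) / real_of_int (int_decode y)"
    by (simp add: rat_code_def nat_to_rat_surj_def c Fract_of_int_quotient of_rat_divide)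
  also have "\<dots> = (real (int_pos x) - real (int_neg x)) / (real (int_pos y) - real (int_neg y))"
    by (simp add: int_decode_pos_neg)
  also have "\<dots> = (real (rat_pos c) - real (rat_neg c)) / real (rat_den c)"
  proof (cases "int_pos y = 0 \<and> int_neg y = 0")
    case False
    then have d: "1 - (int_pos y ^ 2 + int_neg y ^ 2) = 0"
      by (auto simp: not_less_eq_eq Suc_le_eq)
    \<comment> \<open>One of the two parts of \<open>y\<close> vanishes, so the sum of their squares
      is the square of the decoded integer.\<close>
    then show ?thesis using False int_pos_neg_0[of y]
      by (auto simp: rat_pos_def rat_neg_def rat_den_def c Let_def divide_simps power2_eq_square algebra_simps)
  qed (simp add: rat_pos_def rat_neg_def c)
  finally show ?thesis .
qed

lemma computable_rat_pos [computable_intros]: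
  assumes "computable n a"
  shows "computable n (\<lambda>\<Phi> \<rho>. rat_pos (a \<Phi> \<rho>))"
  unfolding rat_pos_def Let_def int_pos_def int_neg_def using assms by (intro computable_intros)

lemma computable_rat_neg [computable_intros]:
  assumes "computable n a"
  shows "computable n (\<lambda>\<Phi> \<rho>. rat_neg (a \<Phi> \<rho>))"
  unfolding rat_neg_def Let_def int_pos_def int_neg_def using assms by (intro computable_intros)

lemma computable_rat_den [computable_intros]:
  assumes "computable n a"
  shows "computable n (\<lambda>\<Phi> \<rho>. rat_den (a \<Phi> \<rho>))"
  unfolding rat_den_def Let_def int_pos_def int_neg_def using assms by (intro computable_intros)

text \<open>Even codes are those of the nonnegative integers, hence the doubling.\<close>

definition frac_code :: "nat \<Rightarrow> nat \<Rightarrow> nat" where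
  "frac_code u d = prod_encode (2 * u, 2 * d)"

lemma rat_code_frac_code: "rat_code (frac_code u d) = real u / real d"
  by (simp add: rat_code_def frac_code_def nat_to_rat_surj_def int_decode_def sum_decode_def
      Fract_of_int_quotient of_rat_divide)

lemma computable_frac_code [computable_intros]:
  assumes "computable n a" "computable n b"
  shows "computable n (\<lambda>\<Phi> \<rho>. frac_code (a \<Phi> \<rho>) (b \<Phi> \<rho>))"
  unfolding frac_code_def using assms by (intro computable_intros)

section \<open>Approximating a point where the function is large\<close>

text \<open>Density of the rationals suffices for a proper interval. In the degenerate case the only
  candidate is \<open>p\<close>, which is why \<open>p\<close> has to be rational.\<close>

lemma rational_near_in_interval:
  fixes p q z \<epsilon> :: real
  assumes "p \<in> \<rat>" "z \<in> {p..q}" "0 < \<epsilon>"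
  obtains s where "s \<in> \<rat>" "s \<in> {p..q}" "\<bar>s - z\<bar> < \<epsilon>"
proof (cases "p = q")
  case True
  then show ?thesis using assms that[of p] by auto
next
  case False
  then have "max p (z - \<epsilon>) < min q (z + \<epsilon>)" using assms by auto
  then obtain s where "s \<in> \<rat>" "max p (z - \<epsilon>) < s" "s < min q (z + \<epsilon>)"
    using Rats_dense_in_real by blast
  then show ?thesis by (intro that[of s]) auto
qed

lemma nonneg_Rats_frac:
  fixes s :: real
  assumes "s \<in> \<rat>" "0 \<le> s"
  obtains u d where "s = real u / real (Suc d)"
proof -
  obtain m n :: nat where "n \<noteq> 0" "\<bar>s\<bar> = real m / real n"
    using Rats_abs_nat_div_natE[OF assms(1)] by metis
  then show ?thesis using assms(2) that[of m "n - 1"] by simp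
qed

text \<open>Soundness of the guesses. By \<open>near\<close>, all sequences \<open>s n m\<close>
  converge to one point \<open>z\<close>; continuity removes the error \<open>3 / 2 ^ j\<close>, and
  the limits over \<open>m\<close> and \<open>n\<close> preserve the non-strict bound.\<close>

lemma Baire2_greater_of_approximations:
  fixes s :: "nat \<Rightarrow> nat \<Rightarrow> nat \<Rightarrow> real"
  assumes f: "effectively_Baire2_by f F" and pq: "0 \<le> p" "q \<le> 1"
    and s: "\<And>n m j. s n m j \<in> {p..q}"
    and near: "\<And>n m j n' m' j'. s n m j \<le> s n' m' j' + 1 / 2 ^ j + 1 / 2 ^ j'"
    and above: "\<And>n m j. N \<le> n \<Longrightarrow> M n \<le> m \<Longrightarrow> c \<le> F n m (s n m j) + 3 / 2 ^ j"
  shows "\<exists>z\<in>{p..q}. c \<le> f z"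
proof -
  have null: "(\<lambda>j. C / 2 ^ j) \<longlonglongrightarrow> 0" for C :: real
    using tendsto_mult_right_zero[OF LIMSEQ_power_zero[of "1/2::real"], of C]
    by (simp add: power_divide)
  have "Cauchy (s 0 0)"
  proof (rule metric_CauchyI)
    fix e :: real assume "0 < e"
    then have "\<forall>\<^sub>F j in sequentially. 2 / 2 ^ j < e"
      using order_tendstoD(2)[OF null[of 2]] by blast
    then obtain J where J: "2 / 2 ^ J < e" by (auto simp: eventually_sequentially)
    show "\<exists>J. \<forall>j\<ge>J. \<forall>j'\<ge>J. dist (s 0 0 j) (s 0 0 j') < e"
    proof (intro exI allI impI)
      fix j j' assume "J \<le> j" "J \<le> j'"
      then have "1 / 2 ^ j \<le> (1 / 2 ^ J :: real)" "1 / 2 ^ j' \<le> (1 / 2 ^ J :: real)"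
        by (simp_all add: field_simps)
      with J near[of 0 0 j 0 0 j'] near[of 0 0 j' 0 0 j] show "dist (s 0 0 j) (s 0 0 j') < e"
        by (simp add: dist_real_def abs_less_iff)
    qed
  qed
  then obtain z where z: "s 0 0 \<longlonglongrightarrow> z" using Cauchy_convergent convergent_def by blast
  have zpq: "z \<in> {p..q}"
    using closed_sequentially[OF closed_atLeastAtMost _ z] s by blast
  have close: "\<bar>s n m j - z\<bar> \<le> 1 / 2 ^ j" for n m j
  proof -
    \<comment> \<open>Comparing \<open>s n m j\<close> with the reference sequence
      \<open>s 0 0\<close> and passing to its limit gives a rate of convergence to the same
      \<open>z\<close> for all \<open>n\<close> and \<open>m\<close>.\<close>
    have "(\<lambda>i. s 0 0 i + 1 / 2 ^ j + 1 / 2 ^ i) \<longlonglongrightarrow> z + 1 / 2 ^ j + 0"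
      by (intro tendsto_intros z null)
    then have "s n m j \<le> z + 1 / 2 ^ j + 0"
      by (rule LIMSEQ_le_const) (use near in blast)
    moreover have "(\<lambda>i. s n m j + 1 / 2 ^ i + 1 / 2 ^ j) \<longlonglongrightarrow> s n m j + 0 + 1 / 2 ^ j"
      by (intro tendsto_intros null)
    then have "z \<le> s n m j + 0 + 1 / 2 ^ j"
      by (rule LIMSEQ_le[OF z]) (use near in blast)
    ultimately show ?thesis by simp
  qed
  have lim: "s n m \<longlonglongrightarrow> z" for n m
  proof (rule Lim_transform_bound[OF _ null[of 1], THEN LIM_zero_cancel])
    show "\<forall>\<^sub>F j in sequentially. norm (s n m j - z) \<le> norm (1 / 2 ^ j :: real)"
      using close by simp
  qed
  have s01: "s n m j \<in> {0..1}" for n m j using s[of n m j] pq by auto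
  have F: "c \<le> F n m z" if "N \<le> n" "M n \<le> m" for n m
  proof -
    have "continuous_on {0..1} (F n m)"
      using f by (simp add: effectively_Baire2_by_def)
    then have "(\<lambda>j. F n m (s n m j)) \<longlonglongrightarrow> F n m z"
      by (rule continuous_on_tendsto_compose[OF _ lim]) (use zpq pq s01 in auto)
    then have "(\<lambda>j. F n m (s n m j) + 3 / 2 ^ j) \<longlonglongrightarrow> F n m z + 0"
      by (intro tendsto_add null)
    then have "c \<le> F n m z + 0"
      by (rule LIMSEQ_le_const) (use above that in blast)
    then show ?thesis by simp
  qed
  have z01: "z \<in> {0..1}" using zpq pq by auto
  have "c \<le> lim (\<lambda>m. F n m z)" if "N \<le> n" for n
  proof -
    have "(\<lambda>m. F n m z) \<longlonglongrightarrow> lim (\<lambda>m. F n m z)"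
      using f z01 by (simp add: effectively_Baire2_by_def convergent_LIMSEQ_iff)
    then show ?thesis by (rule LIMSEQ_le_const) (use F that in blast)
  qed
  moreover have "(\<lambda>n. lim (\<lambda>m. F n m z)) \<longlonglongrightarrow> f z"
    using f z01 by (simp add: effectively_Baire2_by_def)
  ultimately have "c \<le> f z" by (intro LIMSEQ_le_const[of _ "f z"]) auto
  then show ?thesis using zpq by blast
qed

text \<open>Completeness of the guesses. The iterated limit yields a gap \<open>K\<close>, a
  threshold \<open>N\<close> and bounds \<open>M\<close>; continuity of each \<open>F n m\<close> at
  \<open>z\<close> yields the fractions.\<close>

lemma Baire2_approximations_of_greater:
  assumes f: "effectively_Baire2_by f F" and pq: "0 \<le> p" "q \<le> 1" "p \<in> \<rat>"
    and z: "z \<in> {p..q}" "r < f z"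
  obtains M :: "nat \<Rightarrow> nat" and u d :: "nat \<Rightarrow> nat \<Rightarrow> nat \<Rightarrow> nat" where
    "\<And>n m j. real (u n m j) / real (Suc (d n m j)) \<in> {p..q}"
    "\<And>n m j. \<bar>real (u n m j) / real (Suc (d n m j)) - z\<bar> \<le> 1 / 2 ^ j"
    "\<And>n m j. M 0 \<le> n \<Longrightarrow> M n \<le> m \<Longrightarrow>
       r + 1 / 2 ^ M 0 \<le> F n m (real (u n m j) / real (Suc (d n m j))) + 1 / 2 ^ j"
proof -
  have z01: "z \<in> {0..1}" using z pq by auto
  obtain K :: nat where K: "(1/2) ^ K < f z - r"
    using real_arch_pow_inv[of "f z - r" "1/2"] z by auto
  let ?c = "r + 1 / 2 ^ K"
  have "?c < f z" using K by (simp add: power_divide)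
  moreover have "(\<lambda>n. lim (\<lambda>m. F n m z)) \<longlonglongrightarrow> f z"
    using f z01 by (simp add: effectively_Baire2_by_def)
  ultimately have "\<forall>\<^sub>F n in sequentially. ?c < lim (\<lambda>m. F n m z)"
    using order_tendstoD(1) by blast
  then obtain N where N: "\<And>n. N \<le> n \<Longrightarrow> ?c < lim (\<lambda>m. F n m z)"
    by (auto simp: eventually_sequentially)
  have "\<exists>M. N \<le> n \<longrightarrow> (\<forall>m\<ge>M. ?c \<le> F n m z)" for n
  proof (cases "N \<le> n")
    case True
    have "(\<lambda>m. F n m z) \<longlonglongrightarrow> lim (\<lambda>m. F n m z)"
      using f z01 by (simp add: effectively_Baire2_by_def convergent_LIMSEQ_iff)
    from order_tendstoD(1)[OF this N[OF True]] show ?thesis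
      by (auto simp: eventually_sequentially intro: less_imp_le)
  qed auto
  then obtain M where M: "\<And>n m. N \<le> n \<Longrightarrow> M n \<le> m \<Longrightarrow> ?c \<le> F n m z"
    by metis
  \<comment> \<open>The value at \<open>0\<close> also serves as threshold and as gap exponent.
    Enlarging it keeps the bound for \<open>n = 0\<close> valid, starts later than \<open>N\<close>
    and only shrinks the gap.\<close>
  let ?M = "M(0 := max (max N K) (M 0))"
  define P where "P n m j u d \<longleftrightarrow> real u / real (Suc d) \<in> {p..q} \<and>
      \<bar>real u / real (Suc d) - z\<bar> \<le> 1 / 2 ^ j \<and>
      \<bar>F n m (real u / real (Suc d)) - F n m z\<bar> \<le> 1 / 2 ^ j" for n m j u d
  have "\<exists>u d. P n m j u d" for n m j
  proof -
    have "continuous_on {0..1} (F n m)"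
      using f by (simp add: effectively_Baire2_by_def)
    then obtain \<delta> where \<delta>: "\<delta> > 0"
      "\<And>s. s \<in> {0..1} \<Longrightarrow> dist s z < \<delta> \<Longrightarrow> dist (F n m s) (F n m z) < 1 / 2 ^ j"
      using z01 unfolding continuous_on_iff
      by (metis zero_less_divide_1_iff zero_less_numeral zero_less_power)
    obtain s where s: "s \<in> \<rat>" "s \<in> {p..q}" "\<bar>s - z\<bar> < min \<delta> (1 / 2 ^ j)"
      using rational_near_in_interval[OF pq(3) z(1), of "min \<delta> (1 / 2 ^ j)"] \<delta>(1) by auto
    obtain u d where ud: "s = real u / real (Suc d)"
      using nonneg_Rats_frac[OF s(1)] s(2) pq(1) by auto
    have "\<bar>F n m s - F n m z\<bar> \<le> 1 / 2 ^ j"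
      using \<delta>(2)[of s] s pq by (auto simp: dist_real_def)
    then show ?thesis using s ud unfolding P_def by (intro exI[of _ u] exI[of _ d]) auto
  qed
  then obtain u d where "\<And>n m j. P n m j (u n m j) (d n m j)" by metis
  then have ud: "\<And>n m j. real (u n m j) / real (Suc (d n m j)) \<in> {p..q}"
    "\<And>n m j. \<bar>real (u n m j) / real (Suc (d n m j)) - z\<bar> \<le> 1 / 2 ^ j"
    "\<And>n m j. \<bar>F n m (real (u n m j) / real (Suc (d n m j))) - F n m z\<bar> \<le> 1 / 2 ^ j"
    unfolding P_def by blast+
  show ?thesis
  proof (rule that[of u d ?M])
    fix n m j assume nm: "?M 0 \<le> n" "?M n \<le> m"
    have "?c \<le> F n m z" using nm by (intro M) (auto split: if_splits)
    moreover have "1 / 2 ^ ?M 0 \<le> (1 / 2 ^ K :: real)"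
      by (intro divide_left_mono power_increasing) auto
    ultimately show "r + 1 / 2 ^ ?M 0 \<le> F n m (real (u n m j) / real (Suc (d n m j))) + 1 / 2 ^ j"
      using ud(3)[of n m j] by linarith
  qed (use ud in auto)
qed

section \<open>The tree searched by the Suslin functional\<close>

definition query :: "tp2 \<Rightarrow> nat \<Rightarrow> nat \<Rightarrow> nat \<Rightarrow> nat \<Rightarrow> nat" where
  "query \<Phi> n m j c = \<Phi> (case_nat n (case_nat m (case_nat j (\<lambda>_. c))))"

lemma computable_query [computable_intros]:
  assumes "computable n a" "computable n b" "computable n c" "computable n d"
  shows "computable n (\<lambda>\<Phi> \<rho>. query \<Phi> (a \<Phi> \<rho>) (b \<Phi> \<rho>) (c \<Phi> \<rho>) (d \<Phi> \<rho>))"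
proof (rule computable_app4[OF _ assms])
  show "computable 4 (\<lambda>\<Phi> \<rho>. query \<Phi> (\<rho> 0) (\<rho> 1) (\<rho> 2) (\<rho> 3))"
    unfolding query_def by (intro computable_intros) auto
qed

lemma real_name_const: "real_name (\<lambda>_. c) (rat_code c)"
  by (simp add: real_name_def)

lemma real_name_error:
  assumes "real_name y r"
  shows "\<bar>rat_code (y j) - r\<bar> \<le> 1 / 2 ^ j"
proof (rule LIMSEQ_le_const2)
  have "(\<lambda>i. rat_code (y (i + j))) \<longlonglongrightarrow> r"
    using assms by (auto simp: real_name_def intro: LIMSEQ_ignore_initial_segment)
  then show "(\<lambda>i. \<bar>rat_code (y j) - rat_code (y (i + j))\<bar>) \<longlonglongrightarrow> \<bar>rat_code (y j) - r\<bar>"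
    by (intro tendsto_intros)
  show "\<exists>N. \<forall>i\<ge>N. \<bar>rat_code (y j) - rat_code (y (i + j))\<bar> \<le> 1 / 2 ^ j"
    using assms unfolding real_name_def by (metis add.commute less_imp_le)
qed

lemma query_error:
  assumes "double_seq_name \<Phi> F" "rat_code c \<in> {0..1}"
  shows "\<bar>rat_code (query \<Phi> n m j c) - F n m (rat_code c)\<bar> \<le> 1 / 2 ^ j"
  using assms real_name_const[of c] unfolding double_seq_name_def query_def
  by (intro real_name_error[of "\<lambda>j. \<Phi> (case_nat n (case_nat m (case_nat j (\<lambda>_. c))))"]) blast

section \<open>Rational inequalities, cross-multiplied with negative parts moved across so that no
  truncated subtraction occurs\<close>

definition frac_ge :: "nat \<Rightarrow> nat \<Rightarrow> nat \<Rightarrow> bool" where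
  "frac_ge a u d \<longleftrightarrow> rat_pos a * d \<le> u * rat_den a + rat_neg a * d"

definition frac_le :: "nat \<Rightarrow> nat \<Rightarrow> nat \<Rightarrow> bool" where
  "frac_le b u d \<longleftrightarrow> u * rat_den b + rat_neg b * d \<le> rat_pos b * d"

definition frac_near :: "nat \<Rightarrow> nat \<Rightarrow> nat \<Rightarrow> nat \<Rightarrow> nat \<Rightarrow> nat \<Rightarrow> bool" where
  "frac_near u d j u' d' j' \<longleftrightarrow>
     u * d' * (2 ^ j * 2 ^ j') \<le> u' * d * (2 ^ j * 2 ^ j') + d * d' * (2 ^ j + 2 ^ j')"

definition value_above :: "nat \<Rightarrow> nat \<Rightarrow> nat \<Rightarrow> nat \<Rightarrow> nat \<Rightarrow> bool" where
  "value_above x k N t j \<longleftrightarrow>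
     x * rat_den t * 2 ^ N * 2 ^ j + rat_den t * 2 ^ k * 2 ^ j + rat_neg t * 2 ^ k * 2 ^ N * 2 ^ j
     \<le> rat_pos t * 2 ^ k * 2 ^ N * 2 ^ j + 2 * rat_den t * 2 ^ k * 2 ^ N"

lemma frac_ge_iff: "d > 0 \<Longrightarrow> frac_ge a u d \<longleftrightarrow> rat_code a \<le> real u / real d"
proof -
  assume "d > 0"
  have "frac_ge a u d \<longleftrightarrow> real (rat_pos a * d) \<le> real (u * rat_den a + rat_neg a * d)"
    unfolding frac_ge_def of_nat_le_iff ..
  also have "\<dots> \<longleftrightarrow> rat_code a \<le> real u / real d"
    using \<open>d > 0\<close> rat_den_pos[of a] by (simp add: rat_code_eq field_simps)
  finally show ?thesis .
qed

lemma frac_le_iff: "d > 0 \<Longrightarrow> frac_le b u d \<longleftrightarrow> real u / real d \<le> rat_code b"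
proof -
  assume "d > 0"
  have "frac_le b u d \<longleftrightarrow> real (u * rat_den b + rat_neg b * d) \<le> real (rat_pos b * d)"
    unfolding frac_le_def of_nat_le_iff ..
  also have "\<dots> \<longleftrightarrow> real u / real d \<le> rat_code b"
    using \<open>d > 0\<close> rat_den_pos[of b] by (simp add: rat_code_eq field_simps)
  finally show ?thesis .
qed

lemma frac_near_iff:
  assumes "d > 0" "d' > 0"
  shows "frac_near u d j u' d' j' \<longleftrightarrow> real u / real d \<le> real u' / real d' + 1 / 2 ^ j + 1 / 2 ^ j'"
proof -
  have "frac_near u d j u' d' j' \<longleftrightarrow> real (u * d' * (2 ^ j * 2 ^ j')) \<le>
      real (u' * d * (2 ^ j * 2 ^ j') + d * d' * (2 ^ j + 2 ^ j'))"
    unfolding frac_near_def of_nat_le_iff ..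
  also have "\<dots> \<longleftrightarrow> real u / real d \<le> real u' / real d' + 1 / 2 ^ j + 1 / 2 ^ j'"
    using assms by (simp add: field_simps)
  finally show ?thesis .
qed

text \<open>The slack \<open>2 / 2 ^ j\<close> allows one \<open>1 / 2 ^ j\<close> for the answer of
  \<open>\<Phi>\<close> and one for replacing \<open>z\<close> by a nearby fraction.\<close>

lemma value_above_iff:
  "value_above x k N t j \<longleftrightarrow> real x / 2 ^ k + 1 / 2 ^ N \<le> rat_code t + 2 / 2 ^ j"
proof -
  have "value_above x k N t j \<longleftrightarrow>
     real (x * rat_den t * 2 ^ N * 2 ^ j + rat_den t * 2 ^ k * 2 ^ j + rat_neg t * 2 ^ k * 2 ^ N * 2 ^ j)
     \<le> real (rat_pos t * 2 ^ k * 2 ^ N * 2 ^ j + 2 * rat_den t * 2 ^ k * 2 ^ N)"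
    unfolding value_above_def of_nat_le_iff ..
  also have "\<dots> \<longleftrightarrow> real x / 2 ^ k + 1 / 2 ^ N \<le> rat_code t + 2 / 2 ^ j"
    using rat_den_pos[of t] by (simp add: rat_code_eq field_simps)
  finally show ?thesis .
qed

text \<open>An entry \<open>w = \<langle>u, \<langle>d, M\<rangle>\<rangle>\<close> of a branch stands for the fraction \<open>u / (d + 1)\<close> and the bound
  \<open>M\<close>; its position \<open>i = \<langle>n, \<langle>m, j\<rangle>\<rangle>\<close> says that the fraction serves to evaluate the
  \<open>(n, m)\<close>-th function with precision \<open>2\<^sup>-\<^sup>j\<close>. A node of length \<open>\<langle>i, i'\<rangle> + 1\<close> checks only the pair
  \<open>i, i'\<close> of positions, which avoids bounded quantifiers in the node predicate.\<close>

abbreviation entry_num :: "nat \<Rightarrow> nat" where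
  "entry_num w \<equiv> fst (prod_decode w)"

abbreviation entry_den :: "nat \<Rightarrow> nat" where
  "entry_den w \<equiv> Suc (fst (prod_decode (snd (prod_decode w))))"

abbreviation entry_bound :: "nat \<Rightarrow> nat" where
  "entry_bound w \<equiv> snd (prod_decode (snd (prod_decode w)))"

abbreviation pos_outer :: "nat \<Rightarrow> nat" where
  "pos_outer i \<equiv> fst (prod_decode i)"

abbreviation pos_inner :: "nat \<Rightarrow> nat" where
  "pos_inner i \<equiv> fst (prod_decode (snd (prod_decode i)))"

abbreviation pos_precision :: "nat \<Rightarrow> nat" where
  "pos_precision i \<equiv> snd (prod_decode (snd (prod_decode i)))"

text \<open>\<open>w\<close> and \<open>w'\<close> are the entries at \<open>i\<close> and
  \<open>i'\<close>. The bound for the outer index \<open>n\<close> is taken from \<open>v\<close>,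
  the entry at position \<open>n\<close> itself, so that it cannot vary with the inner index or the
  precision.\<close>

definition entries_ok ::
  "tp2 \<Rightarrow> nat \<Rightarrow> nat \<Rightarrow> nat \<Rightarrow> nat \<Rightarrow> nat \<Rightarrow> nat \<Rightarrow> nat \<Rightarrow> nat \<Rightarrow> nat \<Rightarrow> nat \<Rightarrow> bool" where
  "entries_ok \<Phi> a b x k i i' w w' v N \<longleftrightarrow>
     frac_ge a (entry_num w) (entry_den w) \<and> frac_le b (entry_num w) (entry_den w) \<and>
     frac_near (entry_num w) (entry_den w) (pos_precision i)
       (entry_num w') (entry_den w') (pos_precision i') \<and>
     (N \<le> pos_outer i \<longrightarrow> entry_bound v \<le> pos_inner i \<longrightarrow>
        value_above x k N
          (query \<Phi> (pos_outer i) (pos_inner i) (pos_precision i)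
            (frac_code (entry_num w) (entry_den w)))
          (pos_precision i))"

definition branch_ok :: "tp2 \<Rightarrow> nat \<Rightarrow> nat \<Rightarrow> nat \<Rightarrow> nat \<Rightarrow> nat \<Rightarrow> nat \<Rightarrow> (nat \<Rightarrow> nat) \<Rightarrow> bool" where
  "branch_ok \<Phi> a b x k i i' g \<longleftrightarrow>
     entries_ok \<Phi> a b x k i i' (g i) (g i') (g (pos_outer i)) (entry_bound (g 0))"

definition node_ok :: "tp2 \<Rightarrow> nat \<Rightarrow> nat \<Rightarrow> nat \<Rightarrow> nat \<Rightarrow> nat \<Rightarrow> bool" where
  "node_ok \<Phi> a b x k \<sigma> \<longleftrightarrow> (1 \<le> code_length \<sigma> \<longrightarrow>
     branch_ok \<Phi> a b x k (fst (prod_decode (code_length \<sigma> - Suc 0)))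
       (snd (prod_decode (code_length \<sigma> - Suc 0))) (code_nth \<sigma>))"

definition sup_exceeds :: "tp2 \<Rightarrow> nat \<Rightarrow> nat \<Rightarrow> nat \<Rightarrow> nat \<Rightarrow> bool" where
  "sup_exceeds \<Phi> a b x k \<longleftrightarrow> Suslin (\<lambda>\<sigma>. if node_ok \<Phi> a b x k \<sigma> then 0 else 1) \<le> 0"

text \<open>The precision \<open>k\<close> comes first, as \<open>Kleene_computes_real\<close> puts
  it in front of the other arguments.\<close>

definition sup_name :: "tp2 \<Rightarrow> nat \<Rightarrow> nat \<Rightarrow> nat \<Rightarrow> nat" where
  "sup_name \<Phi> k a b =
     frac_code (rec_nat 0 (\<lambda>x u. if sup_exceeds \<Phi> a b x k then Suc x else u) (2 ^ k)) (2 ^ k)"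

lemma decidable_entries_ok [computable_intros]:
  assumes "computable n a" "computable n b" "computable n x" "computable n k" "computable n i"
    "computable n i'" "computable n w" "computable n w'" "computable n v" "computable n N"
  shows "decidable n (\<lambda>\<Phi> \<rho>. entries_ok \<Phi> (a \<Phi> \<rho>) (b \<Phi> \<rho>) (x \<Phi> \<rho>) (k \<Phi> \<rho>) (i \<Phi> \<rho>) (i' \<Phi> \<rho>)
    (w \<Phi> \<rho>) (w' \<Phi> \<rho>) (v \<Phi> \<rho>) (N \<Phi> \<rho>))"
  unfolding entries_ok_def frac_ge_def frac_le_def frac_near_def value_above_def
  using assms by (intro computable_intros)

lemma computable_sup_name: "computable 3 (\<lambda>\<Phi> \<rho>. sup_name \<Phi> (\<rho> 0) (\<rho> 1) (\<rho> 2))"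
proof -
  have node: "computable n (\<lambda>\<Phi> \<rho>. if node_ok \<Phi> (a \<Phi> \<rho>) (b \<Phi> \<rho>) (x \<Phi> \<rho>) (k \<Phi> \<rho>) (\<sigma> \<Phi> \<rho>) then 0 else 1)"
    if "computable n a" "computable n b" "computable n x" "computable n k" "computable n \<sigma>" for n a b x k \<sigma>
    unfolding node_ok_def branch_ok_def using that by (intro computable_intros)
  show ?thesis
    unfolding sup_name_def sup_exceeds_def
    by (intro node computable_intros) auto
qed

text \<open>Every positive length is \<open>Suc (prod_encode (i, i'))\<close> for exactly one pair,
  so the nodes along \<open>g\<close> check each pair once; the empty node passes by
  default.\<close>

lemma sup_exceeds_iff_branch: "sup_exceeds \<Phi> a b x k \<longleftrightarrow> (\<exists>g. \<forall>i i'. branch_ok \<Phi> a b x k i i' g)"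
proof -
  have "(\<forall>l. node_ok \<Phi> a b x k (initial_segment g l)) \<longleftrightarrow> (\<forall>i i'. branch_ok \<Phi> a b x k i i' g)" for g
  proof -
    have node: "node_ok \<Phi> a b x k (initial_segment g (Suc (prod_encode (i, i')))) \<longleftrightarrow> branch_ok \<Phi> a b x k i i' g" for i i'
    proof -
      have "i < Suc (prod_encode (i, i'))" "i' < Suc (prod_encode (i, i'))"
        by (simp_all add: less_Suc_eq_le le_prod_encode_1 le_prod_encode_2)
      \<comment> \<open>The node must be long enough to contain the entry that holds the bound as
        well.\<close>
      moreover have "pos_outer i \<le> i"
        using le_prod_encode_1[of "fst (prod_decode i)" "snd (prod_decode i)"] by simp
      ultimately show ?thesis
        by (simp add: node_ok_def branch_ok_def code_length_initial_segment code_nth_initial_segment)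
    qed
    have "node_ok \<Phi> a b x k (initial_segment g 0)"
      by (simp add: node_ok_def code_length_initial_segment)
    then show ?thesis using node by (metis not0_implies_Suc prod_decode_inverse surj_pair)
  qed
  moreover have "sup_exceeds \<Phi> a b x k \<longleftrightarrow> (\<exists>g. \<forall>l. node_ok \<Phi> a b x k (initial_segment g l))"
    by (simp add: sup_exceeds_def Suslin_def)
  ultimately show ?thesis by simp
qed

lemma sup_exceeds_iff:
  assumes f: "effectively_Baire2_by f F" and \<Phi>: "double_seq_name \<Phi> F"
    and ab: "0 \<le> rat_code a" "rat_code b \<le> 1"
  shows "sup_exceeds \<Phi> a b x k \<longleftrightarrow> (\<exists>z\<in>{rat_code a..rat_code b}. real x / 2 ^ k < f z)"
proof
  assume "sup_exceeds \<Phi> a b x k"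
  then obtain g where g: "\<And>i i'. branch_ok \<Phi> a b x k i i' g"
    unfolding sup_exceeds_iff_branch by blast
  define w where "w n m j = g (prod_encode (n, prod_encode (m, j)))" for n m j
  define s where "s n m j = real (entry_num (w n m j)) / real (entry_den (w n m j))" for n m j
  define N where "N = entry_bound (g 0)"
  have s: "s n m j \<in> {rat_code a..rat_code b}" for n m j
    using g[of "prod_encode (n, prod_encode (m, j))"]
    by (simp add: branch_ok_def entries_ok_def frac_ge_iff frac_le_iff s_def w_def)
  have near: "s n m j \<le> s n' m' j' + 1 / 2 ^ j + 1 / 2 ^ j'" for n m j n' m' j'
    using g[of "prod_encode (n, prod_encode (m, j))" "prod_encode (n', prod_encode (m', j'))"]
    by (simp add: branch_ok_def entries_ok_def frac_near_iff s_def w_def)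
  have above: "real x / 2 ^ k + 1 / 2 ^ N \<le> F n m (s n m j) + 3 / 2 ^ j"
    if "N \<le> n" "entry_bound (g n) \<le> m" for n m j
  proof -
    let ?c = "frac_code (entry_num (w n m j)) (entry_den (w n m j))"
    have c: "rat_code ?c = s n m j" by (simp add: rat_code_frac_code s_def)
    have "real x / 2 ^ k + 1 / 2 ^ N \<le> rat_code (query \<Phi> n m j ?c) + 2 / 2 ^ j"
      using g[of "prod_encode (n, prod_encode (m, j))"] that
      by (simp add: branch_ok_def entries_ok_def value_above_iff w_def N_def)
    moreover have "\<bar>rat_code (query \<Phi> n m j ?c) - F n m (s n m j)\<bar> \<le> 1 / 2 ^ j"
      using query_error[OF \<Phi>, of ?c n m j] s[of n m j] ab unfolding c by auto
    \<comment> \<open>The slack of the test plus the error of the query.\<close>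
    moreover have "3 / 2 ^ j = 2 / 2 ^ j + (1 / 2 ^ j :: real)" by (simp add: field_simps)
    ultimately show ?thesis by linarith
  qed
  have "\<exists>z\<in>{rat_code a..rat_code b}. real x / 2 ^ k + 1 / 2 ^ N \<le> f z"
    by (rule Baire2_greater_of_approximations[where s = s and N = N and M = "\<lambda>n. entry_bound (g n)",
          OF f ab s near above])
  then obtain z where "z \<in> {rat_code a..rat_code b}" "real x / 2 ^ k + 1 / 2 ^ N \<le> f z" by blast
  \<comment> \<open>The gap, kept through all limits, turns the non-strict bound into a strict
    one.\<close>
  moreover have "0 < (1 / 2 ^ N :: real)" by simp
  ultimately show "\<exists>z\<in>{rat_code a..rat_code b}. real x / 2 ^ k < f z"
    by (metis less_add_same_cancel1 less_le_trans)
next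
  assume "\<exists>z\<in>{rat_code a..rat_code b}. real x / 2 ^ k < f z"
  then obtain z where z: "z \<in> {rat_code a..rat_code b}" "real x / 2 ^ k < f z" by blast
  have "rat_code a \<in> \<rat>" by (simp add: rat_code_def)
  then obtain M :: "nat \<Rightarrow> nat" and u d :: "nat \<Rightarrow> nat \<Rightarrow> nat \<Rightarrow> nat" where
    s: "\<And>n m j. real (u n m j) / real (Suc (d n m j)) \<in> {rat_code a..rat_code b}" and
    near: "\<And>n m j. \<bar>real (u n m j) / real (Suc (d n m j)) - z\<bar> \<le> 1 / 2 ^ j" and
    above: "\<And>n m j. M 0 \<le> n \<Longrightarrow> M n \<le> m \<Longrightarrow>
       real x / 2 ^ k + 1 / 2 ^ M 0 \<le> F n m (real (u n m j) / real (Suc (d n m j))) + 1 / 2 ^ j"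
    using Baire2_approximations_of_greater[OF f ab _ z] by metis
  define U where "U i = u (pos_outer i) (pos_inner i) (pos_precision i)" for i
  define D where "D i = d (pos_outer i) (pos_inner i) (pos_precision i)" for i
  \<comment> \<open>The fraction treats \<open>i\<close> as a coded triple, while the bound treats
    \<open>i\<close> as an outer index; the two uses are independent.\<close>
  define g where "g i = prod_encode (U i, prod_encode (D i, M i))" for i
  have "branch_ok \<Phi> a b x k i i' g" for i i'
  proof -
    have si: "real (U i) / real (Suc (D i)) \<in> {rat_code a..rat_code b}"
      using s by (simp add: U_def D_def)
    have near_z: "\<bar>real (U i) / real (Suc (D i)) - z\<bar> \<le> 1 / 2 ^ pos_precision i" for i
      using near by (simp add: U_def D_def)
    have "real (U i) / real (Suc (D i)) \<le>
        real (U i') / real (Suc (D i')) + 1 / 2 ^ pos_precision i + 1 / 2 ^ pos_precision i'"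
      using near_z[of i] near_z[of i'] by linarith
    moreover have "real x / 2 ^ k + 1 / 2 ^ M 0 \<le>
        rat_code (query \<Phi> (pos_outer i) (pos_inner i) (pos_precision i) (frac_code (U i) (Suc (D i))))
        + 2 / 2 ^ pos_precision i"
      if "M 0 \<le> pos_outer i" "M (pos_outer i) \<le> pos_inner i"
    proof -
      let ?s = "real (U i) / real (Suc (D i))" and ?j = "pos_precision i"
      have c: "rat_code (frac_code (U i) (Suc (D i))) = ?s" by (rule rat_code_frac_code)
      have "real x / 2 ^ k + 1 / 2 ^ M 0 \<le> F (pos_outer i) (pos_inner i) ?s + 1 / 2 ^ ?j"
        using above[OF that] by (simp add: U_def D_def)
      moreover have "\<bar>rat_code (query \<Phi> (pos_outer i) (pos_inner i) ?j (frac_code (U i) (Suc (D i))))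
          - F (pos_outer i) (pos_inner i) ?s\<bar> \<le> 1 / 2 ^ ?j"
      proof -
        have "?s \<in> {0..1}" using si ab unfolding atLeastAtMost_iff by linarith
        then show ?thesis
          using query_error[OF \<Phi>, of "frac_code (U i) (Suc (D i))"] unfolding c by blast
      qed
      moreover have "2 / 2 ^ ?j = 1 / 2 ^ ?j + (1 / 2 ^ ?j :: real)" by (simp add: field_simps)
      ultimately show ?thesis by linarith
    qed
    ultimately show ?thesis
      using si unfolding branch_ok_def entries_ok_def g_def
      by (simp add: frac_ge_iff frac_le_iff frac_near_iff value_above_iff del: of_nat_Suc)
  qed
  then show "sup_exceeds \<Phi> a b x k" unfolding sup_exceeds_iff_branch by blast
qed

section \<open>From comparisons with dyadic rationals to a name of the supremum\<close>

lemma dyadic_upper_approximation: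
  fixes S :: real
  assumes S: "0 \<le> S" "S \<le> 1" and P: "\<And>x. P x \<longleftrightarrow> real x / 2 ^ k < S"
  defines "c \<equiv> rec_nat 0 (\<lambda>x u. if P x then Suc x else u) (2 ^ k)"
  shows "S \<le> real c / 2 ^ k" "real c / 2 ^ k < S + 1 / 2 ^ k"
proof -
  define C where "C = rec_nat 0 (\<lambda>x u. if P x then Suc x else u)"
  \<comment> \<open>The recursion stores one more than the last \<open>x < n\<close> satisfying
    \<open>P\<close>, or \<open>0\<close> if there is none. Thus \<open>P\<close> fails at
    \<open>c\<close> unless \<open>c = 2 ^ k\<close>, where \<open>S \<le> 1\<close> takes over, and
    holds at \<open>c - 1\<close> unless \<open>c = 0\<close>, where \<open>0 \<le> S\<close> takes
    over.\<close>
  have C: "C n \<le> n \<and> (C n = 0 \<or> P (C n - 1)) \<and> (\<forall>x. C n \<le> x \<longrightarrow> x < n \<longrightarrow> \<not> P x)" for n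
    by (induction n) (auto simp: C_def less_Suc_eq)
  have c: "c = C (2 ^ k)" by (simp add: c_def C_def)
  show "S \<le> real c / 2 ^ k"
  proof (cases "c < 2 ^ k")
    case True
    then show ?thesis using C[of "2 ^ k"] P c by auto
  next
    case False
    then have "c = 2 ^ k" using C[of "2 ^ k"] c by simp
    then show ?thesis using S by simp
  qed
  show "real c / 2 ^ k < S + 1 / 2 ^ k"
  proof (cases "c = 0")
    case True
    then show ?thesis using S by (simp add: add_nonneg_pos)
  next
    case False
    then have "real (c - 1) / 2 ^ k < S" using C[of "2 ^ k"] P c by auto
    then show ?thesis using False by (simp add: of_nat_diff field_simps)
  qed
qed

text \<open>From stage \<open>n\<close> on, all values lie in the half-open interval from
  \<open>r\<close> to \<open>r + 1 / 2 ^ n\<close>, which gives the strict inequality required of a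
  name.\<close>

lemma real_name_of_upper_approximations:
  assumes "\<And>k. r \<le> rat_code (y k)" "\<And>k. rat_code (y k) < r + 1 / 2 ^ k"
  shows "real_name y r"
  unfolding real_name_def
proof (intro conjI allI)
  fix n i
  have "1 / 2 ^ (n + i) \<le> (1 / 2 ^ n :: real)"
    by (intro divide_left_mono power_increasing) auto
  then show "\<bar>rat_code (y n) - rat_code (y (n + i))\<bar> < 1 / 2 ^ n"
    using assms[of n] assms[of "n + i"] by linarith
next
  have "(\<lambda>k. r + (1 / 2) ^ k) \<longlonglongrightarrow> r + 0"
    by (intro tendsto_intros LIMSEQ_power_zero) auto
  then show "(\<lambda>k. rat_code (y k)) \<longlonglongrightarrow> r"
    using assms by (intro tendsto_sandwich[of "\<lambda>_. r" "\<lambda>k. rat_code (y k)" _ "\<lambda>k. r + (1 / 2) ^ k"])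
      (auto simp: power_divide intro: less_imp_le always_eventually)
qed

theorem theorem3:
  shows "\<exists>e. \<forall>(f :: real \<Rightarrow> real) (F :: nat \<Rightarrow> nat \<Rightarrow> real \<Rightarrow> real) (\<Phi> :: tp2) (p :: real) (q :: real) (a :: nat) (b :: nat).
    f \<in> {0..1} \<rightarrow> {0..1} \<longrightarrow>
    effectively_Baire2_by f F \<longrightarrow>
    double_seq_name \<Phi> F \<longrightarrow>
    p \<in> \<rat> \<inter> {0..1} \<longrightarrow> q \<in> \<rat> \<inter> {0..1} \<longrightarrow> p \<le> q \<longrightarrow>
    rat_code a = p \<longrightarrow> rat_code b = q \<longrightarrow>
    Kleene_computes_real e [a, b] [Suslin, \<Phi>] (SUP x\<in>{p..q}. f x)"
proof -
  \<comment> \<open>The index is fixed before \<open>f\<close>, \<open>F\<close>,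
    \<open>\<Phi>\<close> and the endpoints, which makes the computation uniform in them.\<close>
  obtain e where e: "\<forall>\<Phi> \<rho>. Kleene e (map \<rho> [0..<3]) [] [Suslin, \<Phi>] (sup_name \<Phi> (\<rho> 0) (\<rho> 1) (\<rho> 2))"
    using computable_sup_name unfolding computable_def ..
  show ?thesis
  proof (intro exI allI impI)
    fix f F \<Phi> p q a b
    assume f01: "f \<in> {0..1} \<rightarrow> {0..1::real}" and f: "effectively_Baire2_by f F"
      and \<Phi>: "double_seq_name \<Phi> F" and "p \<in> \<rat> \<inter> {0..1}" "q \<in> \<rat> \<inter> {0..1}" "p \<le> q"
      and ab: "rat_code a = p" "rat_code b = q"
    then have pq: "0 \<le> p" "q \<le> 1" "p \<in> {p..q}" by auto
    let ?S = "SUP x\<in>{p..q}. f x"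
    have f_pq: "0 \<le> f z" "f z \<le> 1" if "z \<in> {p..q}" for z
      using f01 that pq by (auto simp: Pi_iff)
    have bdd: "bdd_above (f ` {p..q})" using f_pq by (intro bdd_aboveI2[of _ _ 1])
    have S: "0 \<le> ?S" "?S \<le> 1"
    proof -
      show "0 \<le> ?S" using cSUP_upper[OF pq(3) bdd] f_pq(1)[OF pq(3)] by linarith
      show "?S \<le> 1" using pq(3) f_pq(2) by (intro cSUP_least) auto
    qed
    have ex: "sup_exceeds \<Phi> a b x k \<longleftrightarrow> real x / 2 ^ k < ?S" for x k
    proof -
      have "sup_exceeds \<Phi> a b x k \<longleftrightarrow> (\<exists>z\<in>{p..q}. real x / 2 ^ k < f z)"
        using sup_exceeds_iff[OF f \<Phi>] ab pq by simp
      also have "\<dots> \<longleftrightarrow> real x / 2 ^ k < ?S"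
        using pq(3) bdd by (intro less_cSUP_iff[symmetric]) auto
      finally show ?thesis .
    qed
    have "real_name (\<lambda>k. sup_name \<Phi> k a b) ?S"
      using dyadic_upper_approximation[OF S ex]
      by (intro real_name_of_upper_approximations) (simp_all add: sup_name_def rat_code_frac_code)
    moreover have "Kleene e [k, a, b] [] [Suslin, \<Phi>] (sup_name \<Phi> k a b)" for k
      using e[rule_format, of "\<lambda>i. [k, a, b] ! i" \<Phi>] by (simp add: numeral_3_eq_3 numeral_2_eq_2)
    ultimately show "Kleene_computes_real e [a, b] [Suslin, \<Phi>] ?S"
      unfolding Kleene_computes_real_def by blast
  qed
qed

end
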